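(* Let $n$ be an integral power of $2$. For every metric space $(M,d)$, opening cost $f>0$ and demand sequence $u_1,\dots,u_n$ of length $n$, Frac-SumRad maintains online a feasible fractional solution whose total cost $\sum_{j}\sum_{k=1}^{K+1} x_{jk}c_k$ is $O(\log\log n)$ times the minimum cost of an offline integral solution (a collection of clusters $C(p_i,\rho_i)$ covering all demands, of cost $\sum_i (f+\rho_i)$).
   Context: A cluster $C(p,r)=\{v\in M:d(p,v)\le r\}$ costs $f+r$. Let $K=\log_2 n$, and for $k=1,\dots,K+1$ let $r_k=2^k f$ and $c_k=f+r_k$. Algorithm Frac-SumRad knows $n$ in advance and maintains nonnegative fractions $x_{jk}$ (for each arrived demand $u_j$ and each $k=1,\dots,K+1$, the extent to which $C(u_j,r_k)$ is open; $x_{jk}=0$ before $u_j$ arrives), which only increase. Let $F_j=\sum_{k=1}^{K+1}\sum_{i:\,u_j\in C(u_i,r_k)} x_{ik}$. When $u_j$ arrives, while $F_j<1$ it repeats the operation: (1) for every $k=1,\dots,K+1$, $x_{jk}\leftarrow x_{jk}+\frac{1}{c_k(K+1)}$; (2) for every $k=1,\dots,K+1$ and every arrived demand $u_i\in C(u_j,r_k)$, $x_{ik}\leftarrow x_{ik}(1+\frac{1}{c_k})$. A fractional solution is feasible if $F_j\ge 1$ for every arrived demand $u_j$.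
   Formalization: The O-constant is uniform only over opening costs f ≥ f0 for each fixed f0 > 0: with all demands at one point the ratio is at least 1/f, so none serves all f > 0. It is stated per type of points (finite subspaces embed in the naturals, so one serves all); the cost bound is for n ≥ 4. *)

theory Defs
  imports "HOL-Analysis.Analysis" "HOL-Library.While_Combinator" "HOL-Library.Discrete_Functions"
begin

text \<open>
  The demands of a sequence of length \<open>n\<close> are \<open>u 1, \<dots>, u n\<close>. The cluster
  \<open>C(p, r)\<close> of a metric space \<open>(M, d)\<close> is the library's closed ball.
\<close>

abbreviation cluster :: "'a set \<Rightarrow> ('a \<Rightarrow> 'a \<Rightarrow> real) \<Rightarrow> 'a \<Rightarrow> real \<Rightarrow> 'a set" where
  "cluster \<equiv> Metric_space.mcball"

text \<open>Offline integral solutions\<close>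

definition offline_solution ::
  "'a set \<Rightarrow> ('a \<Rightarrow> 'a \<Rightarrow> real) \<Rightarrow> nat \<Rightarrow> (nat \<Rightarrow> 'a) \<Rightarrow> ('a \<times> real) set \<Rightarrow> bool" where
  "offline_solution M d n u S \<longleftrightarrow>
     finite S \<and> (\<forall>(p, \<rho>) \<in> S. p \<in> M \<and> \<rho> \<ge> 0) \<and>
     (\<forall>j \<in> {1..n}. \<exists>(p, \<rho>) \<in> S. u j \<in> cluster M d p \<rho>)"

definition offline_cost :: "real \<Rightarrow> ('a \<times> real) set \<Rightarrow> real" where
  "offline_cost f S = (\<Sum>(p, \<rho>) \<in> S. f + \<rho>)"

text \<open>
  An infimum rather than a minimum: in an infinite space the centres can be chosen
  from infinitely many points, and the optimal cost need not be attained.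
\<close>

definition opt_cost ::
  "'a set \<Rightarrow> ('a \<Rightarrow> 'a \<Rightarrow> real) \<Rightarrow> real \<Rightarrow> nat \<Rightarrow> (nat \<Rightarrow> 'a) \<Rightarrow> real" where
  "opt_cost M d f n u = Inf {offline_cost f S | S. offline_solution M d n u S}"

text \<open>
  A fractional solution is a function \<open>x\<close> with \<open>x j k\<close> the extent to which
  \<open>C(u j, r\<^sub>k)\<close> is open. When \<open>n\<close> is a power of 2, \<open>floor_log n\<close> is exactly \<open>log 2 n\<close>.
\<close>

type_synonym fractions = "nat \<Rightarrow> nat \<Rightarrow> real"

definition levels :: "nat \<Rightarrow> nat set" where
  "levels n = {1..floor_log n + 1}"

definition level_radius :: "real \<Rightarrow> nat \<Rightarrow> real" where
  "level_radius f k = 2 ^ k * f"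

definition level_cost :: "real \<Rightarrow> nat \<Rightarrow> real" where
  "level_cost f k = f + level_radius f k"

text \<open>The quantity \<open>F\<^sub>j\<close> at a time when exactly the demands \<open>u 1, \<dots>, u m\<close> have arrived.\<close>

definition coverage ::
  "'a set \<Rightarrow> ('a \<Rightarrow> 'a \<Rightarrow> real) \<Rightarrow> real \<Rightarrow> nat \<Rightarrow> (nat \<Rightarrow> 'a) \<Rightarrow> nat \<Rightarrow> nat \<Rightarrow> fractions \<Rightarrow> real" where
  "coverage M d f n u m j x =
     (\<Sum>k \<in> levels n. \<Sum>i \<in> {i \<in> {1..m}. u j \<in> cluster M d (u i) (level_radius f k)}. x i k)"

definition frac_cost :: "real \<Rightarrow> nat \<Rightarrow> fractions \<Rightarrow> real" where
  "frac_cost f n x = (\<Sum>j \<in> {1..n}. \<Sum>k \<in> levels n. x j k * level_cost f k)"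

definition add_step :: "real \<Rightarrow> nat \<Rightarrow> nat \<Rightarrow> fractions \<Rightarrow> fractions" where
  "add_step f n j x = (\<lambda>i k.
     if i = j \<and> k \<in> levels n then x i k + 1 / (level_cost f k * real (floor_log n + 1))
     else x i k)"

definition mult_step ::
  "'a set \<Rightarrow> ('a \<Rightarrow> 'a \<Rightarrow> real) \<Rightarrow> real \<Rightarrow> nat \<Rightarrow> (nat \<Rightarrow> 'a) \<Rightarrow> nat \<Rightarrow> fractions \<Rightarrow> fractions" where
  "mult_step M d f n u j x = (\<lambda>i k.
     if i \<in> {1..j} \<and> k \<in> levels n \<and> u i \<in> cluster M d (u j) (level_radius f k)
     then x i k * (1 + 1 / level_cost f k)
     else x i k)"

text \<open>
  The steps are not invariant under scaling of the metric together with \<open>f\<close>: the first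
  \<open>add_step\<close> always costs 1, while the optimum is \<open>f\<close> when all demands coincide. So a
  bound on the competitive ratio can be uniform in \<open>f\<close> only for \<open>f\<close> bounded away from 0.

  The result of a loop is \<open>None\<close> if and only if the loop does not terminate.
\<close>

definition serve ::
  "'a set \<Rightarrow> ('a \<Rightarrow> 'a \<Rightarrow> real) \<Rightarrow> real \<Rightarrow> nat \<Rightarrow> (nat \<Rightarrow> 'a) \<Rightarrow> nat \<Rightarrow> fractions \<Rightarrow> fractions option" where
  "serve M d f n u j =
     while_option (\<lambda>x. coverage M d f n u j j x < 1)
       (\<lambda>x. mult_step M d f n u j (add_step f n j x))"

text \<open>The fractions after the first \<open>m\<close> demands; only \<open>u 1, \<dots>, u m\<close> are inspected.\<close>

primrec frac_sumrad ::
  "'a set \<Rightarrow> ('a \<Rightarrow> 'a \<Rightarrow> real) \<Rightarrow> real \<Rightarrow> nat \<Rightarrow> (nat \<Rightarrow> 'a) \<Rightarrow> nat \<Rightarrow> fractions option" where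
  "frac_sumrad M d f n u 0 = Some (\<lambda>_ _. 0)"
| "frac_sumrad M d f n u (Suc m) =
     Option.bind (frac_sumrad M d f n u m) (serve M d f n u (Suc m))"

text \<open>
  \<open>x m\<close> are the fractions held after \<open>m\<close> arrivals. They are never decreased, and after
  every arrival they are feasible for the demands that have arrived.
\<close>

definition online_feasible ::
  "'a set \<Rightarrow> ('a \<Rightarrow> 'a \<Rightarrow> real) \<Rightarrow> real \<Rightarrow> nat \<Rightarrow> (nat \<Rightarrow> 'a) \<Rightarrow> (nat \<Rightarrow> fractions) \<Rightarrow> bool" where
  "online_feasible M d f n u x \<longleftrightarrow>
     (\<forall>m \<le> n. (\<forall>i k. x m i k \<ge> 0) \<and> (\<forall>i > m. \<forall>k. x m i k = 0) \<and>
               (\<forall>j \<in> {1..m}. coverage M d f n u m j (x m) \<ge> 1)) \<and>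
     (\<forall>m < n. \<forall>i k. x m i k \<le> x (Suc m) i k)"

end

theory Submission
  imports Defs
begin

text \<open>
  One iteration of the loop raises the cost by at most \<open>2 + 1/f\<close>: the additive step costs
  exactly 1, and the multiplicative step costs the value of \<open>F\<^sub>j\<close> after the additive step.

  To count the iterations, replace every offline cluster by a set \<open>A\<close> of diameter at most \<open>r\<^sub>k\<close>,
  with \<open>c\<^sub>k\<close> at most four times the cost of the cluster; an offline solution of cost at least
  \<open>n f\<close>, whose radii may exceed every \<open>r\<^sub>k\<close>, is replaced by singletons of level 1. Let \<open>y\<close> be the sum of \<open>x i k\<close> over the
  demands in \<open>A\<close>. An iteration for a demand in \<open>A\<close> turns \<open>y\<close> into
  \<open>(y + 1 / (c\<^sub>k (K + 1))) (1 + 1 / c\<^sub>k)\<close>, so it multiplies \<open>1 + (K + 1) y\<close> by at least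
  \<open>1 + 1 / c\<^sub>k\<close>, and it only happens while \<open>y < 1\<close>. The potential
  \<open>(c\<^sub>k + 1) ln (1 + (K + 1) y)\<close>, truncated just above its value at \<open>y = 1\<close> and summed over the
  sets \<open>A\<close>, therefore grows by at least 1 in every iteration, and it is
  \<open>O(log K)\<close> times the offline cost. The same potential for singletons gives termination.
\<close>

section \<open>Calculus of the truncated logarithm\<close>

text \<open>\<open>N\<close> stands for K + 1. The slack \<open>ln (1 + 1 / c)\<close> in the cap is
  the gain guaranteed by one iteration, so an iteration that starts at \<open>y\<close> \<le> 1 is
  counted in full.\<close>

definition capped_log :: "real \<Rightarrow> real \<Rightarrow> real \<Rightarrow> real" where
  "capped_log N c y = (c + 1) * min (ln (1 + N * y)) (ln (1 + N) + ln (1 + 1 / c))"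

lemma capped_log_zero: "N \<ge> 0 \<Longrightarrow> c > 0 \<Longrightarrow> capped_log N c 0 = 0"
  by (simp add: capped_log_def)

lemma capped_log_mono:
  assumes "N \<ge> 0" "c > 0" "0 \<le> y" "y \<le> y'"
  shows "capped_log N c y \<le> capped_log N c y'"
proof -
  have "N * y \<le> N * y'" "0 \<le> N * y"
    using assms by (auto intro: mult_left_mono)
  then have "ln (1 + N * y) \<le> ln (1 + N * y')"
    by simp
  then show ?thesis
    unfolding capped_log_def using assms by (intro mult_left_mono min.mono) auto
qed

text \<open>The cap alone gives this bound, however large \<open>y\<close> becomes.\<close>

lemma capped_log_upper:
  assumes "N \<ge> 0" "c > 0"
  shows "capped_log N c y \<le> (c + 1) * (ln (1 + N) + 1 / c)"
proof -
  have "ln (1 + 1 / c) \<le> 1 / c"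
    using assms by (intro ln_add_one_self_le_self) auto
  then show ?thesis
    unfolding capped_log_def using assms by (intro mult_left_mono) auto
qed

text \<open>The additive step raises \<open>N * y\<close> by \<open>1 / c\<close>, which supplies
  the term \<open>1 / c\<close> of \<open>(1 + N * y) * (1 + 1 / c)\<close>. The factor
  \<open>c + 1\<close> turns the gain \<open>ln (1 + 1 / c)\<close> into at least 1.\<close>

lemma capped_log_step:
  assumes N: "N > 0" and c: "c > 0" and y: "0 \<le> y" "y \<le> 1"
    and y': "(y + 1 / (c * N)) * (1 + 1 / c) \<le> y'"
  shows "capped_log N c y + 1 \<le> capped_log N c y'"
proof -
  have pos: "1 + N * y > 0" "1 + 1 / c > 0"
    using N c y by (auto intro: add_pos_nonneg)
  have "(1 + N * y) * (1 + 1 / c) \<le> 1 + N * ((y + 1 / (c * N)) * (1 + 1 / c))"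
    using N c by (simp add: field_simps)
  also have "\<dots> \<le> 1 + N * y'"
    using N y' by (intro add_left_mono mult_left_mono) auto
  finally have "ln ((1 + N * y) * (1 + 1 / c)) \<le> ln (1 + N * y')"
    using pos by (intro ln_mono) auto
  then have growth: "ln (1 + N * y) + ln (1 + 1 / c) \<le> ln (1 + N * y')"
    using pos by (simp add: ln_mult)
  have "N * y \<le> N"
    using N y by (simp add: mult_left_le)
  then have below: "ln (1 + N * y) \<le> ln (1 + N)"
    using pos by simp
  \<comment> \<open>The bound ln z \<le> z - 1 at z = c / (c + 1), to be inverted.\<close>
  have "ln (1 + - (1 / (c + 1))) \<le> - (1 / (c + 1))"
    using c by (intro ln_add_one_self_le_self2) (auto simp: field_simps)
  moreover have "1 + - (1 / (c + 1)) = inverse (1 + 1 / c)"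
    using c by (simp add: field_simps)
  ultimately have "1 / (c + 1) \<le> ln (1 + 1 / c)"
    using pos by (simp add: ln_inverse)
  then have gap: "1 \<le> (c + 1) * ln (1 + 1 / c)"
    using c by (simp add: field_simps)
  have nonneg: "ln (1 + 1 / c) \<ge> 0"
    using c by simp
  have "capped_log N c y + 1 \<le> (c + 1) * ln (1 + N * y) + (c + 1) * ln (1 + 1 / c)"
    unfolding capped_log_def using below nonneg gap by (simp add: min_def)
  also have "\<dots> \<le> capped_log N c y'"
    unfolding capped_log_def distrib_left [symmetric]
    using growth below c by (intro mult_left_mono) auto
  finally show ?thesis .
qed

section \<open>Rounding radii up to levels\<close>

text \<open>Doubling makes room for the diameter of a ball, and level \<open>K + 1\<close> is there
  for radii up to \<open>2 ^ K * f\<close>.\<close>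

lemma ex_level:
  assumes "f > 0" "0 \<le> \<rho>" "\<rho> \<le> 2 ^ K * f"
  obtains k where "k \<in> {1..K + 1}" "2 * \<rho> \<le> level_radius f k" "level_cost f k \<le> 4 * (f + \<rho>)"
proof -
  define m where "m = (LEAST m. \<rho> \<le> 2 ^ m * f)"
  have m: "\<rho> \<le> 2 ^ m * f" "m \<le> K"
    unfolding m_def using assms by (auto intro: LeastI Least_le)
  \<comment> \<open>By minimality \<open>2 ^ (m - 1) * f < \<rho>\<close> if \<open>m > 0\<close>;
    the term \<open>2 * f\<close> pays for \<open>m = 0\<close>. The level cost is then at most
    \<open>3 * f + 4 * \<rho>\<close>.\<close>
  have "2 ^ Suc m * f \<le> 2 * f + 4 * \<rho>"
  proof (cases m)
    case 0
    then show ?thesis using assms by simp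
  next
    case (Suc l)
    then have "\<not> \<rho> \<le> 2 ^ l * f"
      unfolding m_def using not_less_Least by (metis lessI)
    then show ?thesis using Suc assms by simp
  qed
  then show ?thesis
    using m assms by (intro that [of "Suc m"]) (auto simp: level_radius_def level_cost_def)
qed

section \<open>Instances, the potential, and monotonicity of the steps\<close>

locale sumrad_instance = Metric_space M d
  for M :: "'a set" and d :: "'a \<Rightarrow> 'a \<Rightarrow> real" +
  fixes f :: real and n :: nat and u :: "nat \<Rightarrow> 'a"
  assumes f_pos: "f > 0" and demand_in: "\<And>j. j \<in> {1..n} \<Longrightarrow> u j \<in> M"
begin

definition N where "N = real (floor_log n + 1)"

abbreviation c where "c \<equiv> level_cost f"

abbreviation r where "r \<equiv> level_radius f"

definition iteration :: "nat \<Rightarrow> fractions \<Rightarrow> fractions" where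
  "iteration j x = mult_step M d f n u j (add_step f n j x)"

text \<open>Zeros beyond \<open>m\<close> allow sums over all \<open>n\<close> demands to be read as
  sums over the arrived ones.\<close>

definition supported :: "nat \<Rightarrow> fractions \<Rightarrow> bool" where
  "supported m x \<longleftrightarrow> (\<forall>i k. x i k \<ge> 0) \<and> (\<forall>i > m. \<forall>k. x i k = 0)"

definition mass :: "'a set \<Rightarrow> nat \<Rightarrow> fractions \<Rightarrow> real" where
  "mass A k x = (\<Sum>i \<in> {i \<in> {1..n}. u i \<in> A}. x i k)"

text \<open>The ball condition bounds the diameter of \<open>A\<close> without a distinguished
  centre: every demand in \<open>A\<close> sees the whole set within its own ball of level
  \<open>k\<close>.\<close>

definition levelled_cover :: "('a set \<times> nat) set \<Rightarrow> bool" where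
  "levelled_cover Q \<longleftrightarrow> finite Q \<and>
     (\<forall>(A, k) \<in> Q. k \<in> levels n \<and> (\<forall>p \<in> A. A \<subseteq> mcball p (r k))) \<and>
     (\<forall>j \<in> {1..n}. \<exists>(A, k) \<in> Q. u j \<in> A)"

definition potential :: "('a set \<times> nat) set \<Rightarrow> fractions \<Rightarrow> real" where
  "potential Q x = (\<Sum>(A, k) \<in> Q. capped_log N (c k) (mass A k x))"

definition potential_bound :: "('a set \<times> nat) set \<Rightarrow> real" where
  "potential_bound Q = (\<Sum>(A, k) \<in> Q. (c k + 1) * (ln (1 + N) + 1 / c k))"

lemma N_pos: "N > 0"
  by (simp add: N_def)

lemma c_ge: "c k \<ge> f"
  using f_pos by (simp add: level_cost_def level_radius_def)

lemma c_pos: "c k > 0"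
  using c_ge f_pos by (rule less_le_trans[rotated])

lemma r_nonneg: "r k \<ge> 0"
  using f_pos by (simp add: level_radius_def)

lemma finite_levels: "finite (levels n)"
  by (simp add: levels_def)

lemma card_levels: "real (card (levels n)) = N"
  by (simp add: levels_def N_def)

lemma add_step_eq:
  "add_step f n j x i k = x i k + (if i = j \<and> k \<in> levels n then 1 / (c k * N) else 0)"
  by (simp add: add_step_def N_def)

lemma supported_add_step: "supported j x \<Longrightarrow> supported j (add_step f n j x)"
  using c_pos N_pos by (auto simp: supported_def add_step_eq less_imp_le intro!: add_nonneg_nonneg)

lemma mult_step_eq:
  "mult_step M d f n u j x i k =
     x i k + (if i \<in> {1..j} \<and> k \<in> levels n \<and> u i \<in> mcball (u j) (r k) then x i k / c k else 0)"
  by (simp add: mult_step_def distrib_left)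

lemma supported_iteration: "supported j x \<Longrightarrow> supported j (iteration j x)"
  using supported_add_step [of j x] c_pos
  by (auto simp: iteration_def supported_def mult_step_eq less_imp_le intro!: add_nonneg_nonneg)

lemma iteration_ge:
  assumes "supported j x"
  shows "x i k \<le> iteration j x i k"
proof -
  have "x i k \<le> add_step f n j x i k"
    using c_pos [of k] N_pos by (simp add: add_step_eq)
  also have "\<dots> \<le> iteration j x i k"
    using supported_add_step [OF assms] c_pos [of k]
    by (simp add: iteration_def mult_step_eq supported_def less_imp_le)
  finally show ?thesis .
qed

lemma coverage_mono:
  assumes "m \<le> m'" "\<And>i k. 0 \<le> x i k" "\<And>i k. x i k \<le> y i k"
  shows "coverage M d f n u m j x \<le> coverage M d f n u m' j y"
  unfolding coverage_def
proof (rule sum_mono)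
  fix k
  let ?I = "\<lambda>m. {i \<in> {1..m}. u j \<in> mcball (u i) (r k)}"
  have "(\<Sum>i \<in> ?I m. x i k) \<le> (\<Sum>i \<in> ?I m'. x i k)"
    using assms by (intro sum_mono2) auto
  also have "\<dots> \<le> (\<Sum>i \<in> ?I m'. y i k)"
    using assms by (intro sum_mono)
  finally show "(\<Sum>i \<in> ?I m. x i k) \<le> (\<Sum>i \<in> ?I m'. y i k)" .
qed

section \<open>Cost of one iteration\<close>

text \<open>A demand lies in its own balls, so each of the \<open>N\<close> levels adds
  \<open>1 / (c k * N)\<close>, at most \<open>1 / (f * N)\<close>.\<close>

lemma coverage_add_step:
  assumes j: "j \<in> {1..n}"
  shows "coverage M d f n u j j (add_step f n j x) \<le> coverage M d f n u j j x + 1 / f"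
proof -
  have "coverage M d f n u j j (add_step f n j x) =
    coverage M d f n u j j x + (\<Sum>k \<in> levels n. 1 / (c k * N))"
    unfolding coverage_def sum.distrib [symmetric]
  proof (rule sum.cong [OF refl])
    fix k assume k: "k \<in> levels n"
    let ?I = "{i \<in> {1..j}. u j \<in> mcball (u i) (r k)}"
    have "j \<in> ?I"
      using j demand_in r_nonneg by auto
    then have "(\<Sum>i \<in> ?I. if i = j then 1 / (c k * N) else 0) = 1 / (c k * N)"
      by (subst sum.delta) auto
    then show "(\<Sum>i \<in> ?I. add_step f n j x i k) = (\<Sum>i \<in> ?I. x i k) + 1 / (c k * N)"
      using k by (simp add: add_step_eq sum.distrib)
  qed
  also have "(\<Sum>k \<in> levels n. 1 / (c k * N)) \<le> (\<Sum>k \<in> levels n. 1 / (f * N))"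
    using c_ge f_pos N_pos by (intro sum_mono divide_left_mono mult_right_mono) (auto simp: c_pos)
  also have "\<dots> = 1 / f"
    using N_pos by (simp add: card_levels)
  finally show ?thesis by simp
qed

text \<open>The weight \<open>c k\<close> cancels, leaving \<open>1 / N\<close> for each of the
  \<open>N\<close> levels.\<close>

lemma frac_cost_add_step:
  assumes "j \<in> {1..n}"
  shows "frac_cost f n (add_step f n j x) = frac_cost f n x + 1"
proof -
  have "add_step f n j x i k * c k = x i k * c k + (if i = j then 1 / N else 0)"
    if "k \<in> levels n" for i k
    using that c_pos [of k] N_pos by (simp add: add_step_eq field_simps)
  then have "frac_cost f n (add_step f n j x) =
      frac_cost f n x + (\<Sum>i \<in> {1..n}. \<Sum>k \<in> levels n. if i = j then 1 / N else 0)"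
    by (simp add: frac_cost_def sum.distrib)
  also have "(\<Sum>i \<in> {1..n}. \<Sum>k \<in> levels n. if i = j then 1 / N else 0) =
      (\<Sum>i \<in> {1..n}. if i = j then 1 else 0)"
    using N_pos by (intro sum.cong) (auto simp: card_levels)
  also have "\<dots> = 1"
    using assms by (subst sum.delta) auto
  finally show ?thesis .
qed

text \<open>An increment \<open>x i k / c k\<close> costs \<open>x i k\<close>, and by symmetry of
  \<open>d\<close> the fractions raised are exactly those summed in the coverage.\<close>

lemma frac_cost_mult_step:
  assumes "j \<in> {1..n}"
  shows "frac_cost f n (mult_step M d f n u j x) = frac_cost f n x + coverage M d f n u j j x"
proof -
  let ?J = "\<lambda>k. {i \<in> {1..j}. u j \<in> mcball (u i) (r k)}"
  have "mult_step M d f n u j x i k * c k = x i k * c k + (if i \<in> ?J k then x i k else 0)"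
    if "k \<in> levels n" for i k
    using that c_pos [of k] by (auto simp: mult_step_eq field_simps commute)
  then have "frac_cost f n (mult_step M d f n u j x) =
      frac_cost f n x + (\<Sum>i \<in> {1..n}. \<Sum>k \<in> levels n. if i \<in> ?J k then x i k else 0)"
    by (simp add: frac_cost_def sum.distrib cong: if_cong)
  also have "(\<Sum>i \<in> {1..n}. \<Sum>k \<in> levels n. if i \<in> ?J k then x i k else 0) =
      (\<Sum>k \<in> levels n. \<Sum>i \<in> {1..n}. if i \<in> ?J k then x i k else 0)"
    by (rule sum.swap)
  also have "\<dots> = coverage M d f n u j j x"
    unfolding coverage_def
  proof (rule sum.cong [OF refl])
    fix k
    have "{1..n} \<inter> ?J k = ?J k"
      using assms by auto
    then show "(\<Sum>i \<in> {1..n}. if i \<in> ?J k then x i k else 0) = (\<Sum>i \<in> ?J k. x i k)"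
      by (subst sum.inter_restrict [symmetric]) auto
  qed
  finally show ?thesis .
qed

lemma frac_cost_iteration:
  assumes "j \<in> {1..n}" "coverage M d f n u j j x < 1"
  shows "frac_cost f n (iteration j x) \<le> frac_cost f n x + (2 + 1 / f)"
  unfolding iteration_def frac_cost_mult_step [OF assms(1)] frac_cost_add_step [OF assms(1)]
  using coverage_add_step [OF assms(1), of x] assms(2) by linarith

section \<open>Growth of the potential in one iteration\<close>

lemma mass_nonneg: "supported m x \<Longrightarrow> 0 \<le> mass A k x"
  by (auto simp: mass_def supported_def intro: sum_nonneg)

text \<open>The mass is part of the level \<open>k\<close> summand of the coverage, so the loop
  condition keeps it below 1 for a set containing the demand being served.\<close>

lemma mass_le_coverage:
  assumes x: "supported j x" and j: "j \<in> {1..n}" and k: "k \<in> levels n"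
    and A: "A \<subseteq> mcball (u j) (r k)"
  shows "mass A k x \<le> coverage M d f n u j j x"
proof -
  have "mass A k x = (\<Sum>i \<in> {i \<in> {1..j}. u i \<in> A}. x i k)"
    unfolding mass_def using x j
    by (intro sum.mono_neutral_right) (auto simp: supported_def not_le [symmetric])
  also have "\<dots> \<le> (\<Sum>i \<in> {i \<in> {1..j}. u j \<in> mcball (u i) (r k)}. x i k)"
    using A x by (intro sum_mono2) (auto simp: supported_def commute)
  also have "\<dots> \<le> coverage M d f n u j j x"
    unfolding coverage_def using k x finite_levels
    by (intro member_le_sum [where i = k]) (auto simp: supported_def intro: sum_nonneg)
  finally show ?thesis .
qed

text \<open>Only index \<open>j\<close> gets the additive increment, and every arrived demand in
  \<open>A\<close> is close enough to \<open>u j\<close> to be multiplied.\<close>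

lemma mass_iteration:
  assumes x: "supported j x" and j: "j \<in> {1..n}" and k: "k \<in> levels n"
    and A: "u j \<in> A" "A \<subseteq> mcball (u j) (r k)"
  shows "mass A k (iteration j x) = (mass A k x + 1 / (c k * N)) * (1 + 1 / c k)"
proof -
  let ?I = "{i \<in> {1..n}. u i \<in> A}"
  \<comment> \<open>For \<open>i > j\<close> both sides are 0, as that demand has not
    arrived.\<close>
  have "iteration j x i k = add_step f n j x i k * (1 + 1 / c k)" if "i \<in> ?I" for i
    using that k A supported_add_step [OF x]
    by (auto simp: iteration_def mult_step_eq supported_def distrib_left not_le)
  then have "mass A k (iteration j x) = (\<Sum>i \<in> ?I. add_step f n j x i k) * (1 + 1 / c k)"
    by (simp add: mass_def sum_distrib_right)
  also have "(\<Sum>i \<in> ?I. add_step f n j x i k) = mass A k x + 1 / (c k * N)"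
  proof -
    have "(\<Sum>i \<in> ?I. if i = j then 1 / (c k * N) else 0) = 1 / (c k * N)"
      using j A by (subst sum.delta) auto
    then show ?thesis
      using k by (simp add: add_step_eq sum.distrib mass_def)
  qed
  finally show ?thesis .
qed

lemma potential_upper: "potential Q x \<le> potential_bound Q"
  unfolding potential_def potential_bound_def
  using N_pos c_pos by (intro sum_mono) (auto intro!: capped_log_upper)

text \<open>One pair whose set contains \<open>u j\<close> gains at least 1; the others cannot lose,
  since fractions never decrease.\<close>

lemma potential_iteration:
  assumes x: "supported j x" and j: "j \<in> {1..n}" and cov: "coverage M d f n u j j x < 1"
    and Q: "levelled_cover Q"
  shows "potential Q x + 1 \<le> potential Q (iteration j x)"
proof -
  let ?g = "\<lambda>x (A, k). capped_log N (c k) (mass A k x)"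
  obtain A k where Ak: "(A, k) \<in> Q" "u j \<in> A" "k \<in> levels n" "A \<subseteq> mcball (u j) (r k)"
    using Q j unfolding levelled_cover_def by fast
  have fin: "finite Q"
    using Q by (simp add: levelled_cover_def)
  have "?g x (A, k) + 1 \<le> ?g (iteration j x) (A, k)"
    using mass_le_coverage [OF x j Ak(3,4)] cov mass_nonneg [OF x]
      mass_iteration [OF x j Ak(3,2,4)] N_pos c_pos
    by (simp add: capped_log_step)
  moreover have "mass B l x \<le> mass B l (iteration j x)" for B l
    unfolding mass_def using iteration_ge [OF x] by (intro sum_mono)
  then have "(\<Sum>q \<in> Q - {(A, k)}. ?g x q) \<le> (\<Sum>q \<in> Q - {(A, k)}. ?g (iteration j x) q)"
    using N_pos c_pos mass_nonneg [OF x]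
    by (intro sum_mono) (auto intro!: capped_log_mono simp: less_imp_le)
  ultimately show ?thesis
    unfolding potential_def using fin Ak(1) by (simp add: sum.remove)
qed

section \<open>Termination and the online run\<close>

text \<open>Serves twice: to bound the number of iterations, and to replace expensive offline
  solutions. Level 1 exists for every \<open>n\<close>.\<close>

lemma singletons_levelled_cover: "levelled_cover ((\<lambda>j. ({u j}, 1)) ` {1..n})"
  unfolding levelled_cover_def
proof (intro conjI ballI)
  show "case q of (A, k) \<Rightarrow> k \<in> levels n \<and> (\<forall>p \<in> A. A \<subseteq> mcball p (r k))"
    if "q \<in> (\<lambda>j. ({u j}, 1)) ` {1..n}" for q
    using that demand_in r_nonneg by (auto simp: levels_def)
  show "\<exists>(A, k) \<in> (\<lambda>j. ({u j}, 1)) ` {1..n}. u j \<in> A" if "j \<in> {1..n}" for j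
    using that by (intro bexI [of _ "({u j}, 1)"]) auto
qed simp

lemma serve_terminates:
  assumes j: "j \<in> {1..n}" and x: "supported j x"
  shows "\<exists>y. serve M d f n u j x = Some y"
  unfolding serve_def iteration_def [symmetric]
proof (rule measure_while_option_Some)
  define Q where "Q = (\<lambda>j. ({u j}, 1::nat)) ` {1..n}"
  \<comment> \<open>The difference stays nonnegative and drops by at least 1 per iteration, so its
    floor is a strictly decreasing natural number.\<close>
  let ?h = "\<lambda>x. nat \<lfloor>potential_bound Q - potential Q x\<rfloor>"
  show "supported j x" by fact
  fix y assume y: "supported j y" "coverage M d f n u j j y < 1"
  have "potential Q y + 1 \<le> potential Q (iteration j y)"
    using potential_iteration [OF y(1) j y(2)] singletons_levelled_cover Q_def by blast
  then have "?h (iteration j y) < ?h y"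
    using potential_upper [of Q "iteration j y"] by linarith
  then show "supported j (iteration j y) \<and> ?h (iteration j y) < ?h y"
    using supported_iteration y(1) by blast
qed

text \<open>The cost is charged to all covers simultaneously, as the algorithm knows none of them.
  The difference form telescopes over the demands.\<close>

lemma serve_invariants:
  assumes j: "j \<in> {1..n}" and x: "supported j x" and y: "serve M d f n u j x = Some y"
  shows "supported j y" "\<And>i k. x i k \<le> y i k" "coverage M d f n u j j y \<ge> 1"
    "\<And>Q. levelled_cover Q \<Longrightarrow>
       frac_cost f n y - frac_cost f n x \<le> (2 + 1 / f) * (potential Q y - potential Q x)"
proof -
  define Inv where "Inv z \<longleftrightarrow> supported j z \<and> (\<forall>i k. x i k \<le> z i k) \<and>
    (\<forall>Q. levelled_cover Q \<longrightarrow>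
       frac_cost f n z - frac_cost f n x \<le> (2 + 1 / f) * (potential Q z - potential Q x))" for z
  have loop: "while_option (\<lambda>x. coverage M d f n u j j x < 1) (iteration j) x = Some y"
    using y by (simp add: serve_def iteration_def [abs_def])
  have "Inv y"
  proof (rule while_option_rule [OF _ loop, of Inv])
    show "Inv x"
      using x by (simp add: Inv_def)
    fix z assume z: "Inv z" and cov: "coverage M d f n u j j z < 1"
    have sup: "supported j z"
      using z by (simp add: Inv_def)
    show "Inv (iteration j z)"
      unfolding Inv_def
    proof (intro conjI allI impI)
      show "supported j (iteration j z)"
        by (rule supported_iteration [OF sup])
      show "x i k \<le> iteration j z i k" for i k
        using z iteration_ge [OF sup, of i k] by (auto simp: Inv_def intro: order_trans)
      fix Q assume Q: "levelled_cover Q"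
      have "(2 + 1 / f) * 1 \<le> (2 + 1 / f) * (potential Q (iteration j z) - potential Q z)"
        using potential_iteration [OF sup j cov Q] f_pos by (intro mult_left_mono) auto
      moreover have "frac_cost f n z - frac_cost f n x \<le> (2 + 1 / f) * (potential Q z - potential Q x)"
        using z Q by (simp add: Inv_def)
      ultimately show "frac_cost f n (iteration j z) - frac_cost f n x
          \<le> (2 + 1 / f) * (potential Q (iteration j z) - potential Q x)"
        using frac_cost_iteration [OF j cov] by (simp add: right_diff_distrib)
    qed
  qed
  then show "supported j y" "\<And>i k. x i k \<le> y i k"
    "\<And>Q. levelled_cover Q \<Longrightarrow>
       frac_cost f n y - frac_cost f n x \<le> (2 + 1 / f) * (potential Q y - potential Q x)"
    by (auto simp: Inv_def)
  show "coverage M d f n u j j y \<ge> 1"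
    using while_option_stop [OF loop] by simp
qed

lemma supported_Suc: "supported m x \<Longrightarrow> supported (Suc m) x"
  by (simp add: supported_def)

text \<open>The charges of the single demands add up, starting from cost 0 and potential 0.\<close>

lemma frac_sumrad_run:
  assumes "m \<le> n"
  shows "\<exists>x. frac_sumrad M d f n u m = Some x \<and> supported m x \<and>
    (\<forall>j \<in> {1..m}. coverage M d f n u m j x \<ge> 1) \<and>
    (\<forall>Q. levelled_cover Q \<longrightarrow> frac_cost f n x \<le> (2 + 1 / f) * potential Q x)"
  using assms
proof (induction m)
  case 0
  have "potential Q (\<lambda>_ _. 0) = 0" for Q
    unfolding potential_def using N_pos c_pos
    by (intro sum.neutral) (auto simp: mass_def capped_log_zero)
  then show ?case
    by (simp add: supported_def frac_cost_def)
next
  case (Suc m)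
  then obtain x where x: "frac_sumrad M d f n u m = Some x" "supported m x"
    "\<And>j. j \<in> {1..m} \<Longrightarrow> coverage M d f n u m j x \<ge> 1"
    "\<And>Q. levelled_cover Q \<Longrightarrow> frac_cost f n x \<le> (2 + 1 / f) * potential Q x"
    by auto
  have j: "Suc m \<in> {1..n}"
    using Suc.prems by simp
  obtain y where y: "serve M d f n u (Suc m) x = Some y"
    using serve_terminates [OF j supported_Suc [OF x(2)]] by blast
  note inv = serve_invariants [OF j supported_Suc [OF x(2)] y]
  have "coverage M d f n u (Suc m) j y \<ge> 1" if "j \<in> {1..Suc m}" for j
  proof (cases "j = Suc m")
    case False
    then have "1 \<le> coverage M d f n u m j x"
      using that by (intro x(3)) auto
    \<comment> \<open>Later arrivals and larger fractions only help an earlier demand.\<close>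
    also have "\<dots> \<le> coverage M d f n u (Suc m) j y"
      using x(2) inv(2) by (intro coverage_mono) (auto simp: supported_def)
    finally show ?thesis .
  qed (use inv(3) in simp)
  moreover have "frac_cost f n y \<le> (2 + 1 / f) * potential Q y" if "levelled_cover Q" for Q
    using x(4) [OF that] inv(4) [OF that] by (simp add: right_diff_distrib)
  ultimately show ?case
    using x(1) y inv(1) by auto
qed

lemma frac_sumrad_mono:
  assumes "m < n" "frac_sumrad M d f n u m = Some x" "frac_sumrad M d f n u (Suc m) = Some y"
  shows "x i k \<le> y i k"
proof -
  have "supported (Suc m) x"
    using frac_sumrad_run [of m] assms(1,2) supported_Suc by auto
  then show ?thesis
    using serve_invariants(2) [of "Suc m" x y] assms by simp
qed

lemma online_feasible_frac_sumrad:
  assumes "\<And>m. m \<le> n \<Longrightarrow> frac_sumrad M d f n u m = Some (x m)"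
  shows "online_feasible M d f n u x"
  unfolding online_feasible_def
proof (intro conjI allI impI)
  fix m assume "m \<le> n"
  then have "supported m (x m)" "\<forall>j \<in> {1..m}. coverage M d f n u m j (x m) \<ge> 1"
    using frac_sumrad_run [of m] assms [of m] by auto
  then show "0 \<le> x m i k" "m < i \<Longrightarrow> x m i k = 0" "\<forall>j \<in> {1..m}. 1 \<le> coverage M d f n u m j (x m)" for i k
    by (auto simp: supported_def)
next
  fix m i k assume "m < n"
  then show "x m i k \<le> x (Suc m) i k"
    by (intro frac_sumrad_mono [of m] assms) auto
qed

section \<open>Comparison with offline solutions\<close>

text \<open>Below the threshold \<open>n * f\<close> every radius is at most
  \<open>2 ^ K * f\<close> and fits a level; from the threshold on, \<open>n\<close> singletons at
  cost \<open>3 * f\<close> each are cheap enough.\<close>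

lemma levelled_cover_of_offline:
  assumes S: "offline_solution M d n u S" and n: "n = 2 ^ K"
  obtains Q where "levelled_cover Q" "(\<Sum>(A, k) \<in> Q. c k) \<le> 4 * offline_cost f S"
proof (cases "offline_cost f S < real n * f")
  case False
  define Q where "Q = (\<lambda>j. ({u j}, 1::nat)) ` {1..n}"
  \<comment> \<open>Only an inequality, as coinciding demands share a singleton.\<close>
  have "(\<Sum>(A, k) \<in> Q. c k) \<le> (\<Sum>j \<in> {1..n}. c 1)"
    unfolding Q_def using sum_image_le [of "{1..n}" "\<lambda>(A, k). c k" "\<lambda>j. ({u j}, 1::nat)"] c_pos
    by (simp add: o_def less_imp_le)
  also have "\<dots> = 3 * (real n * f)"
    by (simp add: level_cost_def level_radius_def)
  also have "\<dots> \<le> 4 * offline_cost f S"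
    using False f_pos by (auto intro: mult_mono)
  finally show ?thesis
    using that [of Q] singletons_levelled_cover Q_def by blast
next
  case True
  have fin: "finite S" and rad: "\<And>p \<rho>. (p, \<rho>) \<in> S \<Longrightarrow> p \<in> M \<and> \<rho> \<ge> 0"
    and cov: "\<And>j. j \<in> {1..n} \<Longrightarrow> \<exists>(p, \<rho>) \<in> S. u j \<in> mcball p \<rho>"
    using S by (auto simp: offline_solution_def)
  have levels: "levels n = {1..K + 1}"
    by (simp add: levels_def n)
  have "\<exists>k \<in> levels n. 2 * snd q \<le> r k \<and> c k \<le> 4 * (f + snd q)" if "q \<in> S" for q
  proof -
    have "0 \<le> f + snd q" if "q \<in> S" for q
      using that rad [of "fst q" "snd q"] f_pos by auto
    \<comment> \<open>A single cluster costs no more than the whole solution, hence less than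
      \<open>n * f\<close>.\<close>
    then have "f + snd q \<le> (\<Sum>q \<in> S. f + snd q)"
      using that fin by (intro member_le_sum) auto
    then have "f + snd q \<le> offline_cost f S"
      by (simp add: offline_cost_def case_prod_unfold)
    then have "snd q \<le> 2 ^ K * f" "0 \<le> snd q"
      using True n f_pos rad [of "fst q" "snd q"] that by auto
    then show ?thesis
      using ex_level [OF f_pos, of "snd q" K] levels by metis
  qed
  then obtain \<kappa> where \<kappa>: "\<And>q. q \<in> S \<Longrightarrow> \<kappa> q \<in> levels n \<and> 2 * snd q \<le> r (\<kappa> q) \<and> c (\<kappa> q) \<le> 4 * (f + snd q)"
    by metis
  let ?h = "\<lambda>q. (mcball (fst q) (snd q), \<kappa> q)"
  \<comment> \<open>Any point of a ball can serve as centre once the radius is doubled.\<close>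
  have diam: "mcball p \<rho> \<subseteq> mcball v R" if "2 * \<rho> \<le> R" "v \<in> mcball p \<rho>" for p v \<rho> R
  proof
    fix w assume w: "w \<in> mcball p \<rho>"
    have "d v w \<le> d v p + d p w"
      using w that by (intro triangle) auto
    then show "w \<in> mcball v R"
      using w that by (auto simp: commute)
  qed
  have "levelled_cover (?h ` S)"
    unfolding levelled_cover_def
  proof (intro conjI ballI)
    show "finite (?h ` S)"
      using fin by simp
    show "case q of (A, k) \<Rightarrow> k \<in> levels n \<and> (\<forall>p \<in> A. A \<subseteq> mcball p (r k))" if "q \<in> ?h ` S" for q
      using that \<kappa> diam by force
    show "\<exists>(A, k) \<in> ?h ` S. u j \<in> A" if "j \<in> {1..n}" for j
      using cov [OF that] by force
  qed
  moreover have "(\<Sum>(A, k) \<in> ?h ` S. c k) \<le> 4 * offline_cost f S"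
  proof -
    have "(\<Sum>(A, k) \<in> ?h ` S. c k) \<le> (\<Sum>q \<in> S. c (\<kappa> q))"
      using sum_image_le [of S "\<lambda>(A, k). c k" ?h] fin c_pos by (simp add: o_def less_imp_le case_prod_unfold)
    also have "\<dots> \<le> (\<Sum>q \<in> S. 4 * (f + snd q))"
      using \<kappa> by (intro sum_mono) auto
    also have "\<dots> = 4 * offline_cost f S"
      by (simp add: offline_cost_def sum_distrib_left case_prod_unfold)
    finally show ?thesis .
  qed
  ultimately show ?thesis
    by (rule that)
qed

text \<open>Since \<open>c k\<close> \<ge> \<open>f0\<close>, adding 1 to \<open>c k\<close> costs a
  factor \<open>1 + 1 / f0\<close>. So does adding \<open>1 / c k\<close> to the logarithm, because
  the latter is at least 1.\<close>

lemma potential_bound_le: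
  assumes "0 < f0" "f0 \<le> f" "1 \<le> ln (1 + N)"
  shows "potential_bound Q \<le> (1 + 1 / f0)\<^sup>2 * ln (1 + N) * (\<Sum>(A, k) \<in> Q. c k)"
proof -
  have "(c k + 1) * (ln (1 + N) + 1 / c k) \<le> (1 + 1 / f0)\<^sup>2 * ln (1 + N) * c k" for k
  proof -
    have c: "f0 \<le> c k"
      using c_ge [of k] assms by simp
    have "c k + 1 \<le> c k * (1 + 1 / f0)"
      using c assms by (simp add: field_simps)
    moreover have "1 / c k \<le> 1 / f0"
      using c assms by (simp add: frac_le)
    then have "1 / c k \<le> 1 / f0 * ln (1 + N)"
      using assms by (metis divide_pos_pos less_eq_real_def mult_left_mono mult.right_neutral order_trans zero_less_one)
    then have "ln (1 + N) + 1 / c k \<le> (1 + 1 / f0) * ln (1 + N)"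
      by (simp add: distrib_right)
    ultimately have "(c k + 1) * (ln (1 + N) + 1 / c k)
        \<le> (c k * (1 + 1 / f0)) * ((1 + 1 / f0) * ln (1 + N))"
      using assms c_pos [of k] by (intro mult_mono) auto
    then show ?thesis
      by (simp add: power2_eq_square mult_ac)
  qed
  then show ?thesis
    unfolding potential_bound_def sum_distrib_left by (intro sum_mono) auto
qed

text \<open>The 8 is the 4 lost in replacing offline clusters times the 2 in
  \<open>ln (K + 2)\<close> \<le> \<open>2 * log 2 K\<close>.\<close>

lemma frac_cost_le_offline:
  assumes f0: "0 < f0" "f0 \<le> f" and n: "n = 2 ^ K" "K \<ge> 2"
    and x: "frac_sumrad M d f n u n = Some x" and S: "offline_solution M d n u S"
  shows "frac_cost f n x \<le> 8 * (2 + 1 / f0) * (1 + 1 / f0)\<^sup>2 * log 2 (real K) * offline_cost f S"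
proof -
  obtain Q where Q: "levelled_cover Q" "(\<Sum>(A, k) \<in> Q. c k) \<le> 4 * offline_cost f S"
    using levelled_cover_of_offline [OF S n(1)] .
  have "floor_log n = K"
    by (simp add: n)
  then have N: "1 + N = real K + 2"
    by (simp add: N_def)
  have "exp 1 \<le> 1 + N"
    using exp_le n(2) by (simp add: N)
  then have ln_ge: "1 \<le> ln (1 + N)"
    using N_pos by (simp add: ln_ge_iff)
  \<comment> \<open>For \<open>K\<close> \<ge> 2, \<open>K + 2\<close> \<le> \<open>2 * K\<close>
    \<le> \<open>K ^ 2\<close>.\<close>
  have "2 * real K \<le> real K * real K" "2 \<le> real K"
    using n(2) by (auto intro: mult_right_mono)
  then have "1 + N \<le> real K ^ 2"
    unfolding N power2_eq_square by linarith
  then have "ln (1 + N) \<le> ln (real K ^ 2)"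
    using N_pos by (intro ln_mono) auto
  also have "\<dots> = 2 * ln 2 * log 2 (real K)"
    using n(2) by (simp add: log_def ln_realpow)
  also have "\<dots> \<le> 2 * log 2 (real K)"
    using n(2) ln_2_less_1 by (intro mult_right_mono) auto
  finally have ln_le: "ln (1 + N) \<le> 2 * log 2 (real K)" .
  have cost_nonneg: "0 \<le> offline_cost f S"
    unfolding offline_cost_def using S f_pos
    by (intro sum_nonneg) (auto simp: offline_solution_def)
  have "potential_bound Q \<le> (1 + 1 / f0)\<^sup>2 * ln (1 + N) * (\<Sum>(A, k) \<in> Q. c k)"
    by (rule potential_bound_le [OF f0 ln_ge])
  also have "\<dots> \<le> (1 + 1 / f0)\<^sup>2 * (2 * log 2 (real K)) * (4 * offline_cost f S)"
    using Q(2) ln_le ln_ge cost_nonneg c_pos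
    by (intro mult_mono mult_left_mono) (auto intro!: sum_nonneg simp: less_imp_le)
  finally have bound: "potential_bound Q \<le> (1 + 1 / f0)\<^sup>2 * (2 * log 2 (real K)) * (4 * offline_cost f S)" .
  \<comment> \<open>Nonnegativity allows \<open>1 / f\<close> to be replaced by its upper bound
    \<open>1 / f0\<close>.\<close>
  have "0 \<le> (1 + 1 / f0)\<^sup>2 * (2 * log 2 (real K)) * (4 * offline_cost f S)"
    using n(2) cost_nonneg by (intro mult_nonneg_nonneg) auto
  moreover have "frac_cost f n x \<le> (2 + 1 / f) * potential Q x"
    using frac_sumrad_run [of n] x Q(1) by auto
  then have "frac_cost f n x \<le> (2 + 1 / f) * ((1 + 1 / f0)\<^sup>2 * (2 * log 2 (real K)) * (4 * offline_cost f S))"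
    using bound potential_upper [of Q x] f_pos
    by (elim order_trans) (intro mult_left_mono; auto)
  ultimately have "frac_cost f n x \<le> (2 + 1 / f0) * ((1 + 1 / f0)\<^sup>2 * (2 * log 2 (real K)) * (4 * offline_cost f S))"
    using f0 by (elim order_trans) (intro mult_right_mono; auto simp: frac_le)
  moreover have "(2 + 1 / f0) * (a * (2 * l) * (4 * o')) = 8 * (2 + 1 / f0) * a * l * o'" for a l o'
    by simp
  ultimately show ?thesis
    by (simp only:)
qed

text \<open>Makes the infimum defining the optimum range over a nonempty set.\<close>

lemma singletons_offline_solution: "offline_solution M d n u ((\<lambda>j. (u j, 0)) ` {1..n})"
  unfolding offline_solution_def
proof (intro conjI ballI)
  show "\<exists>(p, \<rho>) \<in> (\<lambda>j. (u j, 0)) ` {1..n}. u j \<in> mcball p \<rho>" if "j \<in> {1..n}" for j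
    using that demand_in by (intro bexI [of _ "(u j, 0)"]) auto
qed (use demand_in in auto)

text \<open>The optimum is an infimum, so the bound is divided by its positive factor to become a
  lower bound on all offline costs.\<close>

lemma frac_cost_le_opt:
  assumes f0: "0 < f0" "f0 \<le> f" and n: "n = 2 ^ K" "K \<ge> 2"
    and x: "frac_sumrad M d f n u n = Some x"
  shows "frac_cost f n x \<le> 8 * (2 + 1 / f0) * (1 + 1 / f0)\<^sup>2 * log 2 (real K) * opt_cost M d f n u"
proof -
  define A where "A = 8 * (2 + 1 / f0) * (1 + 1 / f0)\<^sup>2 * log 2 (real K)"
  \<comment> \<open>Here \<open>K\<close> \<ge> 2 makes \<open>log 2 (real K)\<close>
    positive.\<close>
  have A: "A > 0"
    unfolding A_def using f0 n(2) by (intro mult_pos_pos zero_less_power add_pos_pos) auto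
  have "frac_cost f n x / A \<le> opt_cost M d f n u"
    unfolding opt_cost_def
  proof (rule cInf_greatest)
    show "{offline_cost f S | S. offline_solution M d n u S} \<noteq> {}"
      using singletons_offline_solution by blast
    show "frac_cost f n x / A \<le> z" if "z \<in> {offline_cost f S | S. offline_solution M d n u S}" for z
      using that frac_cost_le_offline [OF f0 n x, folded A_def] A
      by (auto simp: pos_divide_le_eq mult.commute)
  qed
  then show ?thesis
    using A unfolding A_def [symmetric] by (simp add: pos_divide_le_eq mult.commute)
qed

end

text \<open>For \<open>n = 2\<close> the double logarithm is 0, while the first additive step
  already costs 1; hence the ratio is claimed from \<open>n = 4\<close> on.\<close>

theorem theorem7:
  fixes f0 :: real
  assumes "f0 > 0"
  shows "\<exists>C::real. \<forall>(M::'a set) (d::'a \<Rightarrow> 'a \<Rightarrow> real) (f::real) (n::nat) (u::nat \<Rightarrow> 'a).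
           Metric_space M d \<and> f \<ge> f0 \<and> (\<exists>K::nat. n = 2 ^ K) \<and> (\<forall>j \<in> {1..n}. u j \<in> M) \<longrightarrow>
           (\<exists>x::nat \<Rightarrow> fractions.
              (\<forall>m \<le> n. frac_sumrad M d f n u m = Some (x m)) \<and>
              online_feasible M d f n u x \<and>
              (n \<ge> 4 \<longrightarrow>
                frac_cost f n (x n) \<le> C * log 2 (log 2 (real n)) * opt_cost M d f n u))"
proof (intro exI [of _ "8 * (2 + 1 / f0) * (1 + 1 / f0)\<^sup>2"] allI impI)
  fix M :: "'a set" and d f and n :: nat and u
  assume asm: "Metric_space M d \<and> f \<ge> f0 \<and> (\<exists>K::nat. n = 2 ^ K) \<and> (\<forall>j \<in> {1..n}. u j \<in> M)"
  then obtain K where n: "n = 2 ^ K"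
    by blast
  interpret Metric_space M d
    using asm by blast
  interpret sumrad_instance M d f n u
    by unfold_locales (use asm assms in auto)
  \<comment> \<open>Up to \<open>n\<close> the run is defined, so \<open>the\<close> is safe; later
    values are arbitrary.\<close>
  define x where "x m = the (frac_sumrad M d f n u m)" for m
  have x: "frac_sumrad M d f n u m = Some (x m)" if "m \<le> n" for m
    using frac_sumrad_run [OF that] by (auto simp: x_def)
  have "frac_cost f n (x n) \<le> 8 * (2 + 1 / f0) * (1 + 1 / f0)\<^sup>2 * log 2 (log 2 (real n)) * opt_cost M d f n u"
    if "n \<ge> 4"
  proof -
    have "(2::nat) ^ 2 \<le> 2 ^ K"
      using that n by simp
    then have "K \<ge> 2"
      by (rule power_le_imp_le_exp [rotated]) simp
    moreover have "log 2 (real n) = real K"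
      by (simp add: n)
    ultimately show ?thesis
      using frac_cost_le_opt [OF assms _ n, of "x n"] x asm by simp
  qed
  then show "\<exists>x. (\<forall>m \<le> n. frac_sumrad M d f n u m = Some (x m)) \<and> online_feasible M d f n u x \<and>
      (n \<ge> 4 \<longrightarrow> frac_cost f n (x n)
         \<le> 8 * (2 + 1 / f0) * (1 + 1 / f0)\<^sup>2 * log 2 (log 2 (real n)) * opt_cost M d f n u)"
    using x online_feasible_frac_sumrad by blast
qed

end
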